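(* Let $G\subset\mathrm{SO}(4)$ be a finite subgroup. If $G$ is not generated by rotations, then $\mathbb{R}^4/G$ is not homeomorphic to $\mathbb{R}^4$.
   Context: A rotation is an orientation-preserving orthogonal transformation which is the identity on a real codimension 2 subspace. $\mathbb{R}^4/G$ is the topological orbit space. *)

theory Defs
  imports
    "HOL-Analysis.Analysis"
    "HOL-Algebra.Generated_Groups"
    "HOL-Algebra.Group_Action"
begin

definition special_orthogonal :: "(real^'n^'n) monoid" where
  "special_orthogonal =
     \<lparr>carrier = {A. orthogonal_matrix A \<and> det A = 1}, monoid.mult = (**), one = mat 1\<rparr>"

lemma carrier_special_orthogonal:
  "carrier special_orthogonal = {A :: real^'n^'n. orthogonal_matrix A \<and> det A = 1}"
  by (simp add: special_orthogonal_def)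

lemma group_special_orthogonal: "group (special_orthogonal :: (real^'n^'n) monoid)"
proof (rule groupI)
  fix A :: "real^'n^'n"
  assume "A \<in> carrier special_orthogonal"
  then have "transpose A \<in> carrier special_orthogonal" "transpose A ** A = mat 1"
    by (auto simp: special_orthogonal_def det_transpose orthogonal_matrix_def)
  then show "\<exists>B\<in>carrier special_orthogonal. B \<otimes>\<^bsub>special_orthogonal\<^esub> A = \<one>\<^bsub>special_orthogonal\<^esub>"
    by (intro bexI[of _ "transpose A"]) (auto simp: special_orthogonal_def)
qed (auto simp: special_orthogonal_def orthogonal_matrix_mul orthogonal_matrix_id det_mul
      matrix_mul_assoc)

text \<open>
  Not to be confused with the library's \<^const>\<open>rotation_matrix\<close>, which holds of every element
  of the special orthogonal group. As no exact fixed space is asked for, the identity is a rotation.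
\<close>

definition is_rotation :: "real^'n^'n \<Rightarrow> bool" where
  "is_rotation A \<longleftrightarrow> orthogonal_matrix A \<and> det A = 1 \<and>
     (\<exists>V :: (real^'n) set. subspace V \<and> dim V + 2 = CARD('n) \<and> (\<forall>x\<in>V. A *v x = x))"

definition generated_by_rotations :: "(real^'n^'n) set \<Rightarrow> bool" where
  "generated_by_rotations G \<longleftrightarrow>
     (\<exists>R. (\<forall>A\<in>R. is_rotation A) \<and> generate special_orthogonal R = G)"

abbreviation lin_orbit :: "(real^'n^'n) set \<Rightarrow> real^'n \<Rightarrow> (real^'n) set" where
  "lin_orbit G \<equiv> orbit (special_orthogonal\<lparr>carrier := G\<rparr>) (*v)"

abbreviation lin_orbits :: "(real^'n^'n) set \<Rightarrow> (real^'n) set set" where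
  "lin_orbits G \<equiv> orbits (special_orthogonal\<lparr>carrier := G\<rparr>) UNIV (*v)"

definition orbit_space :: "(real^'n^'n) set \<Rightarrow> (real^'n) set topology" where
  "orbit_space G = topology (\<lambda>U. U \<subseteq> lin_orbits G \<and> open {x. lin_orbit G x \<in> U})"

lemma openin_orbit_space:
  "openin (orbit_space G) U \<longleftrightarrow> U \<subseteq> lin_orbits G \<and> open {x. lin_orbit G x \<in> U}"
proof -
  have "istopology (\<lambda>U. U \<subseteq> lin_orbits G \<and> open {x. lin_orbit G x \<in> U})"
    unfolding istopology_def
  proof (intro conjI allI impI)
    fix \<K> assume *: "\<forall>K\<in>\<K>. K \<subseteq> lin_orbits G \<and> open {x. lin_orbit G x \<in> K}"
    have "{x. lin_orbit G x \<in> \<Union>\<K>} = (\<Union>K\<in>\<K>. {x. lin_orbit G x \<in> K})" by auto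
    then show "open {x. lin_orbit G x \<in> \<Union>\<K>}" using * by auto
    show "\<Union>\<K> \<subseteq> lin_orbits G" using * by blast
  qed (auto simp: Collect_conj_eq)
  then show ?thesis
    by (simp add: orbit_space_def topology_inverse')
qed

lemma topspace_orbit_space: "topspace (orbit_space G) = lin_orbits G"
proof -
  have "{x. lin_orbit G x \<in> lin_orbits G} = UNIV" by (auto simp: orbits_def)
  then have "openin (orbit_space G) (lin_orbits G)" by (simp add: openin_orbit_space)
  then show ?thesis
    using openin_orbit_space[of G "topspace (orbit_space G)"] openin_subset by fastforce
qed

lemma quotient_map_lin_orbit: "quotient_map euclidean (orbit_space G) (lin_orbit G)"
  by (auto simp: quotient_map_def topspace_orbit_space openin_orbit_space orbits_def)

lemma group_action_lin:
  fixes G :: "(real^'n^'n) set"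
  assumes "subgroup G special_orthogonal"
  shows "group_action (special_orthogonal\<lparr>carrier := G\<rparr>) UNIV (*v)"
proof -
  interpret S: group "special_orthogonal :: (real^'n^'n) monoid"
    by (rule group_special_orthogonal)
  have G: "orthogonal_matrix A" if "A \<in> G" for A
    using subgroup.subset[OF assms] that by (auto simp: special_orthogonal_def)
  have bij: "bij ((*v) A)" if "A \<in> G" for A
  proof (rule o_bij)
    show "(*v) (transpose A) \<circ> (*v) A = id" "(*v) A \<circ> (*v) (transpose A) = id"
      using G[OF that] by (auto simp: fun_eq_iff matrix_vector_mul_assoc orthogonal_matrix_def
          simp del: transpose_matrix_vector)
  qed
  have "(*v) \<in> hom (special_orthogonal\<lparr>carrier := G\<rparr>) (BijGroup (UNIV :: (real^'n) set))"
    using bij by (auto simp: hom_def BijGroup_def Bij_def special_orthogonal_def compose_def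
        fun_eq_iff matrix_vector_mul_assoc)
  then show ?thesis
    using S.subgroup_imp_group[OF assms]
    by (simp add: group_action_def group_hom_def group_hom_axioms_def group_BijGroup)
qed

end

theory Submission
  imports Defs
begin

text \<open>
  Let \<open>H\<close> be the subgroup of \<open>G\<close> generated by the elements that fix some nonzero vector. In
  \<open>SO(4)\<close> such an element is a rotation: on the three-dimensional complement of the fixed vector it
  is again special orthogonal, and in odd dimension this forces a further fixed vector
  (\<open>is_rotation_if_fixed_vector\<close>). So it suffices to show \<open>H = G\<close> when \<open>\<real>\<^sup>4/G\<close> is homeomorphic
  to \<open>\<real>\<^sup>4\<close>.

  The subgroup \<open>H\<close> is normal, and \<open>G/H\<close> acts freely on the connected space \<open>(\<real>\<^sup>4 - {0})/H\<close>,
  because \<open>H\<close> contains all stabilizers of nonzero vectors. Hence \<open>(\<real>\<^sup>4 - {0})/H\<close> is a covering of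
  \<open>(\<real>\<^sup>4 - {0})/G\<close> with one sheet for each coset of \<open>H\<close> (\<open>covering_space_proj\<close>). A homeomorphism
  of \<open>\<real>\<^sup>4/G\<close> with \<open>\<real>\<^sup>4\<close> makes the base homeomorphic to \<open>\<real>\<^sup>4\<close> without a point, which is simply
  connected. A connected covering of a simply connected space has a single sheet, so \<open>H = G\<close>
  (\<open>simply_connected_quotient_imp_eq\<close>).
\<close>

section \<open>Orbits of a finite group of orthogonal matrices\<close>

locale finite_orthogonal_group =
  fixes G :: "(real^'n^'n) set"
  assumes finite_group: "finite G"
    and orthogonal: "A \<in> G \<Longrightarrow> orthogonal_matrix A"
    and one_mem: "mat 1 \<in> G"
    and mult_mem: "A \<in> G \<Longrightarrow> B \<in> G \<Longrightarrow> A ** B \<in> G"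
    and transpose_mem: "A \<in> G \<Longrightarrow> transpose A \<in> G"
begin

lemma transpose_cancel:
  assumes "A \<in> G"
  shows "transpose A *v (A *v x) = x" "A *v (transpose A *v x) = x"
  using orthogonal[OF assms]
  by (simp_all add: orthogonal_matrix_def matrix_vector_mul_assoc del: transpose_matrix_vector)

lemma norm_apply: "A \<in> G \<Longrightarrow> norm (A *v x) = norm x"
  using orthogonal
  by (metis orthogonal_transformation_matrix orthogonal_transformation_norm matrix_of_matrix_vector_mul matrix_vector_mul_linear)

lemma dist_apply: "A \<in> G \<Longrightarrow> dist (A *v x) (A *v y) = dist x y"
  by (metis dist_norm matrix_vector_mult_diff_distrib norm_apply)

lemma lin_orbit_eq: "lin_orbit G x = (\<lambda>A. A *v x) ` G"
  by (auto simp: orbit_def)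

lemma mem_lin_orbit: "x \<in> lin_orbit G x"
  unfolding lin_orbit_eq using one_mem by (metis image_eqI matrix_vector_mul_lid)

lemma lin_orbit_eq_iff: "lin_orbit G x = lin_orbit G y \<longleftrightarrow> (\<exists>A\<in>G. y = A *v x)"
proof
  assume "lin_orbit G x = lin_orbit G y"
  with mem_lin_orbit[of y] show "\<exists>A\<in>G. y = A *v x" by (auto simp: lin_orbit_eq)
next
  assume "\<exists>A\<in>G. y = A *v x"
  then obtain A where A: "A \<in> G" "y = A *v x" by blast
  have x: "x = transpose A *v y" using A transpose_cancel by metis
  show "lin_orbit G x = lin_orbit G y"
  proof
    show "lin_orbit G x \<subseteq> lin_orbit G y"
      unfolding lin_orbit_eq x using A(1) mult_mem transpose_mem
      by (auto simp: matrix_vector_mul_assoc simp del: transpose_matrix_vector)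
    show "lin_orbit G y \<subseteq> lin_orbit G x"
      unfolding lin_orbit_eq A(2) using A(1) mult_mem by (auto simp: matrix_vector_mul_assoc)
  qed
qed

lemma open_image_apply:
  assumes "A \<in> G" "open U"
  shows "open ((*v) A ` U)"
proof -
  have "(*v) A ` U = (*v) (transpose A) -` U"
  proof (intro equalityI subsetI)
    fix y assume "y \<in> (*v) A ` U"
    then show "y \<in> (*v) (transpose A) -` U"
      using transpose_cancel(1)[OF assms(1)] by (auto simp del: transpose_matrix_vector)
  next
    fix y assume "y \<in> (*v) (transpose A) -` U"
    then show "y \<in> (*v) A ` U"
      using transpose_cancel(2)[OF assms(1), of y] by (metis imageI vimageD)
  qed
  then show ?thesis
    using assms(2) by (simp add: open_vimage matrix_vector_mult_linear_continuous_on del: transpose_matrix_vector)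
qed

lemma open_lin_orbit_map:
  assumes "open U"
  shows "openin (orbit_space G) (lin_orbit G ` U)"
proof -
  have "{x. lin_orbit G x \<in> lin_orbit G ` U} = (\<Union>A\<in>G. (*v) A ` U)"
  proof (intro equalityI subsetI)
    fix x assume "x \<in> {x. lin_orbit G x \<in> lin_orbit G ` U}"
    then obtain u where "u \<in> U" "lin_orbit G u = lin_orbit G x" by auto
    then show "x \<in> (\<Union>A\<in>G. (*v) A ` U)" unfolding lin_orbit_eq_iff by blast
  next
    fix x assume "x \<in> (\<Union>A\<in>G. (*v) A ` U)"
    then obtain A u where "A \<in> G" "u \<in> U" "x = A *v u" by blast
    then have "lin_orbit G u = lin_orbit G x" unfolding lin_orbit_eq_iff by blast
    then show "x \<in> {x. lin_orbit G x \<in> lin_orbit G ` U}" using \<open>u \<in> U\<close> by auto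
  qed
  then show ?thesis
    using assms open_image_apply by (auto simp: openin_orbit_space orbits_def)
qed

text \<open>
  Embeds the orbit space in a normed space, where lifts along covering maps exist. An orbit is recorded by its distance function.
  Subtracting the norm, which is the distance function of the orbit of the origin, makes that
  function bounded, because every point of the orbit of \<open>x\<close> has norm \<open>norm x\<close>. The supremum metric
  then turns into the distance between orbits.
\<close>

definition profile :: "real^'n \<Rightarrow> ((real^'n) \<Rightarrow>\<^sub>C real)" where
  "profile x = Bcontfun (\<lambda>y. infdist y (lin_orbit G x) - norm y)"

lemma apply_profile: "apply_bcontfun (profile x) y = infdist y (lin_orbit G x) - norm y"
proof -
  have "\<bar>infdist y (lin_orbit G x) - norm y\<bar> \<le> norm x" for y
  proof -
    obtain z where z: "z \<in> lin_orbit G x" "infdist y (lin_orbit G x) = dist y z"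
      using infdist_attains_inf[of "lin_orbit G x" y] mem_lin_orbit finite_group
      by (metis empty_iff finite_imageI finite_imp_closed lin_orbit_eq)
    have "norm z = norm x" using z(1) norm_apply by (auto simp: lin_orbit_eq)
    then show ?thesis unfolding z(2) dist_norm
      by (smt (verit) norm_triangle_ineq4 norm_triangle_ineq2 norm_minus_commute)
  qed
  then have "(\<lambda>y. infdist y (lin_orbit G x) - norm y) \<in> bcontfun"
    by (intro bcontfun_normI[where b = "norm x"] continuous_intros) auto
  then show ?thesis by (simp add: profile_def Bcontfun_inverse)
qed

lemma dist_profile_le: "dist (profile x) (profile y) \<le> dist x y"
proof (rule dist_bound)
  have *: "infdist z (lin_orbit G x) \<le> infdist z (lin_orbit G y) + dist x y" for x y z
  proof -
    obtain A where A: "A \<in> G" "infdist z (lin_orbit G y) = dist z (A *v y)"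
      using infdist_attains_inf[of "lin_orbit G y" z] mem_lin_orbit finite_group
      by (metis (no_types, lifting) empty_iff finite_imageI finite_imp_closed imageE lin_orbit_eq)
    have "infdist z (lin_orbit G x) \<le> dist z (A *v x)"
      using A(1) by (intro infdist_le) (auto simp: lin_orbit_eq)
    also have "\<dots> \<le> dist z (A *v y) + dist x y"
      using dist_triangle2[of z "A *v x" "A *v y"] dist_apply[OF A(1), of x y] by simp
    finally show ?thesis using A by simp
  qed
  show "dist (apply_bcontfun (profile x) z) (apply_bcontfun (profile y) z) \<le> dist x y" for z
    using *[of z x y] *[of z y x] by (simp add: apply_profile dist_real_def dist_commute)
qed

text \<open>
  Evaluating both distance functions at \<open>x\<close>, where one of them vanishes, bounds the supremum
  distance below by the distance from \<open>x\<close> to the orbit of \<open>y\<close>, which a finite orbit attains.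
  Together with the preceding bound this makes \<^term>\<open>profile\<close> an open quotient map onto its range.
\<close>

lemma dist_profile_ge: "\<exists>A\<in>G. dist x (A *v y) \<le> dist (profile x) (profile y)"
proof -
  obtain A where A: "A \<in> G" "infdist x (lin_orbit G y) = dist x (A *v y)"
    using infdist_attains_inf[of "lin_orbit G y" x] mem_lin_orbit finite_group
    by (metis (no_types, lifting) empty_iff finite_imageI finite_imp_closed imageE lin_orbit_eq)
  have "dist (apply_bcontfun (profile x) x) (apply_bcontfun (profile y) x) = dist x (A *v y)"
    using A(2) mem_lin_orbit by (simp add: apply_profile dist_real_def)
  then show ?thesis using A(1) dist_bounded by metis
qed

lemma profile_eq_iff: "profile x = profile y \<longleftrightarrow> (\<exists>A\<in>G. y = A *v x)"
proof
  assume "profile x = profile y"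
  then have "\<exists>A\<in>G. dist y (A *v x) \<le> 0" using dist_profile_ge[of y x] by simp
  then show "\<exists>A\<in>G. y = A *v x" by simp
next
  assume "\<exists>A\<in>G. y = A *v x"
  then have "lin_orbit G x = lin_orbit G y" by (simp add: lin_orbit_eq_iff)
  then show "profile x = profile y" by (simp add: profile_def)
qed

lemma continuous_on_profile: "continuous_on S profile"
  by (rule continuous_on_iff[THEN iffD2]) (meson dist_profile_le le_less_trans)

lemma openin_profile_image:
  assumes "open U"
  shows "openin (top_of_set (range profile)) (profile ` U)"
  unfolding openin_euclidean_subtopology_iff
proof (intro conjI ballI)
  fix z assume "z \<in> profile ` U"
  then obtain u where u: "u \<in> U" "z = profile u" by blast
  obtain r where r: "r > 0" "ball u r \<subseteq> U" using assms u(1) open_contains_ball by blast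
  have "profile x \<in> profile ` U" if "dist (profile x) z < r" for x
  proof -
    obtain A where A: "A \<in> G" "dist u (A *v x) \<le> dist (profile u) (profile x)"
      using dist_profile_ge by blast
    then have "A *v x \<in> U" using that r u by (auto simp: dist_commute)
    moreover have "profile x = profile (A *v x)" using A profile_eq_iff by blast
    ultimately show ?thesis by blast
  qed
  then show "\<exists>e>0. \<forall>x'\<in>range profile. dist x' z < e \<longrightarrow> x' \<in> profile ` U" using r by blast
qed auto

end

section \<open>Covering an orbit space by an intermediate orbit space\<close>

text \<open>
  The setting is a chain of quotients \<open>S \<rightarrow> S/H \<rightarrow> S/G\<close>. The map \<open>q\<close> stands for \<open>S \<rightarrow> S/G\<close>,
  its image being any model of that quotient in a normed space. Since \<open>H\<close> is normal and contains
  every stabilizer, \<open>G/H\<close> acts freely on \<open>S/H\<close>: if \<open>A\<close> maps the \<open>H\<close>-orbit of \<open>x\<close> to itself, then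
  \<open>A *v x = B *v x\<close> with \<open>B \<in> H\<close>, so \<open>A\<close> differs from \<open>B\<close> by an element of the stabilizer of \<open>x\<close>.
\<close>

locale free_quotient_action = G: finite_orthogonal_group G + H: finite_orthogonal_group H
  for G H :: "(real^'n^'n) set" +
  fixes S :: "(real^'n) set" and q :: "real^'n \<Rightarrow> 'b::real_normed_vector"
  assumes subset: "H \<subseteq> G"
    and normal: "A \<in> G \<Longrightarrow> B \<in> H \<Longrightarrow> A ** B ** transpose A \<in> H"
    and open_S: "open S"
    and invariant: "A \<in> G \<Longrightarrow> x \<in> S \<Longrightarrow> A *v x \<in> S"
    and stabilizer: "A \<in> G \<Longrightarrow> x \<in> S \<Longrightarrow> A *v x = x \<Longrightarrow> A \<in> H"
    and continuous_q: "continuous_on S q"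
    and open_q: "\<And>U. open U \<Longrightarrow> U \<subseteq> S \<Longrightarrow> openin (top_of_set (q ` S)) (q ` U)"
    and fibres: "\<And>x y. x \<in> S \<Longrightarrow> y \<in> S \<Longrightarrow> q x = q y \<longleftrightarrow> (\<exists>A\<in>G. y = A *v x)"
begin

text \<open>The induced map \<open>S/H \<rightarrow> S/G\<close>; it does not depend on the chosen representative.\<close>

definition proj where "proj z = q (SOME x. x \<in> S \<and> H.profile x = z)"

lemma proj_profile:
  assumes "x \<in> S" shows "proj (H.profile x) = q x"
proof -
  let ?y = "SOME y. y \<in> S \<and> H.profile y = H.profile x"
  have y: "?y \<in> S \<and> H.profile ?y = H.profile x"
    by (rule someI[of _ x]) (use assms in simp)
  then show ?thesis
    unfolding proj_def using assms subset fibres H.profile_eq_iff by blast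
qed

lemma openin_profile_S:
  assumes "open U" "U \<subseteq> S"
  shows "openin (top_of_set (H.profile ` S)) (H.profile ` U)"
  using H.openin_profile_image[OF assms(1)] assms(2)
  by (meson image_mono openin_subset_trans subset_UNIV)

lemma open_profile_preimage:
  assumes "openin (top_of_set (H.profile ` S)) V"
  shows "open (S \<inter> H.profile -` V)"
  by (meson H.continuous_on_profile assms continuous_openin_preimage image_subset_iff_funcset
      open_S openin_open_eq subset_refl)

lemma continuous_on_proj: "continuous_on (H.profile ` S) proj"
proof (rule continuous_on_open[THEN iffD2], intro allI impI)
  fix T assume T: "openin (top_of_set (proj ` H.profile ` S)) T"
  have im: "proj ` H.profile ` S = q ` S" by (auto simp: proj_profile image_image)
  have "openin (top_of_set S) (S \<inter> q -` T)"
    using T continuous_q im by (metis continuous_on_open)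
  then have "open (S \<inter> q -` T)" using open_S openin_open_eq by blast
  moreover have "H.profile ` S \<inter> proj -` T = H.profile ` (S \<inter> q -` T)"
    by (auto simp: proj_profile)
  ultimately show "openin (top_of_set (H.profile ` S)) (H.profile ` S \<inter> proj -` T)"
    using openin_profile_S by auto
qed

lemma open_proj:
  assumes "openin (top_of_set (H.profile ` S)) V"
  shows "openin (top_of_set (q ` S)) (proj ` V)"
proof -
  have "proj ` V = q ` (S \<inter> H.profile -` V)"
  proof (intro equalityI subsetI)
    fix y assume "y \<in> proj ` V"
    then show "y \<in> q ` (S \<inter> H.profile -` V)"
      using openin_imp_subset[OF assms] proj_profile by blast
  next
    fix y assume "y \<in> q ` (S \<inter> H.profile -` V)"
    then obtain x where "x \<in> S" "H.profile x \<in> V" "y = q x" by blast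
    then show "y \<in> proj ` V" by (metis imageI proj_profile)
  qed
  then show ?thesis using open_q open_profile_preimage[OF assms] by auto
qed

text \<open>
  Finitely many elements of \<open>G - H\<close> all move \<open>x\<close>. A ball of at most half the least displacement is
  therefore disjoint from its images under them.
\<close>

lemma small_ball:
  assumes "x \<in> S"
  obtains r where "r > 0" "ball x r \<subseteq> S"
    "\<And>A y z. A \<in> G \<Longrightarrow> y \<in> ball x r \<Longrightarrow> z \<in> ball x r \<Longrightarrow> A *v y = z \<Longrightarrow> A \<in> H"
proof -
  obtain s where s: "s > 0" "ball x s \<subseteq> S" using open_S assms open_contains_ball by blast
  define \<delta> where "\<delta> = Min (insert s ((\<lambda>A. dist (A *v x) x / 2) ` (G - H)))"
  have fin: "finite (insert s ((\<lambda>A. dist (A *v x) x / 2) ` (G - H)))"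
    using G.finite_group by simp
  have "\<delta> > 0" unfolding \<delta>_def using fin s(1) stabilizer[OF _ assms] by (subst Min_gr_iff) auto
  moreover have "\<delta> \<le> s" unfolding \<delta>_def using fin by (intro Min_le) auto
  moreover have "A \<in> H" if A: "A \<in> G" "y \<in> ball x \<delta>" "z \<in> ball x \<delta>" "A *v y = z" for A y z
  proof (rule ccontr)
    assume "A \<notin> H"
    then have "\<delta> \<le> dist (A *v x) x / 2" unfolding \<delta>_def using fin A(1) by (intro Min_le) auto
    moreover have "dist (A *v x) x \<le> dist (A *v x) (A *v y) + dist z x"
      using dist_triangle A(4) by metis
    ultimately show False using A G.dist_apply[OF A(1), of x y] by (simp add: dist_commute)
  qed
  ultimately show ?thesis using s(2) by (intro that[of \<delta>]) (auto dest: subset_ball)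
qed

text \<open>
  Over the image of a small ball around \<open>x\<close>, the sheets are the images \<open>W A\<close> of the translated balls.
  By the choice of the ball, two translates meet in \<open>S/H\<close> only if they belong to the same coset of
  \<open>H\<close>, and a point of the base has only one preimage in each sheet; both use normality of \<open>H\<close>.
\<close>

lemma covering_space_proj: "covering_space (H.profile ` S) proj (q ` S)"
proof
  show "continuous_on (H.profile ` S) proj" by (rule continuous_on_proj)
  show "proj ` H.profile ` S = q ` S" by (auto simp: proj_profile image_image)
  fix y assume "y \<in> q ` S"
  then obtain x where x: "x \<in> S" "y = q x" by blast
  obtain r where r: "r > 0" "ball x r \<subseteq> S" and
    rH: "\<And>A y z. A \<in> G \<Longrightarrow> y \<in> ball x r \<Longrightarrow> z \<in> ball x r \<Longrightarrow> A *v y = z \<Longrightarrow> A \<in> H"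
    using small_ball[OF x(1)] by metis
  define W where "W A = H.profile ` (*v) A ` ball x r" for A
  have WS: "(*v) A ` ball x r \<subseteq> S" if "A \<in> G" for A using r(2) invariant that by blast
  have q_apply: "q (A *v u) = q u" if "A \<in> G" "u \<in> S" for A u
    using fibres[of u "A *v u"] invariant that by auto
  have union: "\<Union>(W ` G) = H.profile ` S \<inter> proj -` q ` ball x r"
  proof (intro equalityI subsetI)
    fix z assume "z \<in> \<Union>(W ` G)"
    then obtain A u where "A \<in> G" "u \<in> ball x r" "z = H.profile (A *v u)" by (auto simp: W_def)
    then show "z \<in> H.profile ` S \<inter> proj -` q ` ball x r"
      using r(2) q_apply invariant by (auto simp: proj_profile subset_iff)
  next
    fix z assume "z \<in> H.profile ` S \<inter> proj -` q ` ball x r"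
    then obtain s u where s: "s \<in> S" "z = H.profile s" "u \<in> ball x r" "q u = q s"
      by (auto simp: proj_profile)
    then obtain A where "A \<in> G" "s = A *v u" using fibres r(2) by blast
    then show "z \<in> \<Union>(W ` G)" using s unfolding W_def by blast
  qed
  have openW: "openin (top_of_set (H.profile ` S)) (W A)" if "A \<in> G" for A
    unfolding W_def using that WS G.open_image_apply by (intro openin_profile_S) auto
  \<comment> \<open>A common point yields an element of \<open>H\<close> carrying the ball translated by \<open>B\<close> to the one translated by \<open>A\<close>.\<close>
  have sheet: "W A = W B" if AB: "A \<in> G" "B \<in> G" "W A \<inter> W B \<noteq> {}" for A B
  proof -
    obtain z where z: "z \<in> W A" "z \<in> W B" using AB(3) by blast
    obtain u where u: "u \<in> ball x r" "z = H.profile (A *v u)" using z(1) by (auto simp: W_def)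
    obtain v where v: "v \<in> ball x r" "z = H.profile (B *v v)" using z(2) by (auto simp: W_def)
    have "H.profile (A *v u) = H.profile (B *v v)" using u(2) v(2) by simp
    then obtain C where C: "C \<in> H" "B *v v = C *v (A *v u)"
      unfolding H.profile_eq_iff by blast
    have "v = (transpose B ** C ** A) *v u"
      using C(2) G.transpose_cancel(1)[OF AB(2), of v]
      by (simp add: matrix_vector_mul_assoc matrix_mul_assoc del: transpose_matrix_vector)
    moreover have "transpose B ** C ** A \<in> G"
      using AB C(1) subset by (intro G.mult_mem G.transpose_mem) auto
    ultimately have "transpose B ** C ** A \<in> H" using rH u(1) v(1) by blast
    then have "B ** (transpose B ** C ** A) ** transpose B \<in> H" using normal AB by blast
    then have CAB: "C ** (A ** transpose B) \<in> H"
      using G.orthogonal[OF AB(2)] by (simp add: orthogonal_matrix_def matrix_mul_assoc)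
    have D: "A ** transpose B \<in> H"
      using H.mult_mem[OF H.transpose_mem[OF C(1)] CAB] H.orthogonal[OF C(1)]
      by (simp add: orthogonal_matrix_def matrix_mul_assoc)
    have "A *v w = (A ** transpose B) *v (B *v w)" for w
      using G.transpose_cancel(1)[OF AB(2), of w]
      by (simp add: matrix_vector_mul_assoc[symmetric] del: transpose_matrix_vector)
    then have "H.profile (B *v w) = H.profile (A *v w)" for w
      unfolding H.profile_eq_iff using D by blast
    then show ?thesis unfolding W_def image_image by simp
  qed
  have homeo: "\<exists>g. homeomorphism (W A) (q ` ball x r) proj g" if A: "A \<in> G" for A
  proof (rule homeomorphism_injective_open_map)
    show "continuous_on (W A) proj"
      unfolding W_def by (rule continuous_on_subset[OF continuous_on_proj image_mono[OF WS[OF A]]])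
    show "proj ` W A = q ` ball x r"
      unfolding W_def image_image using r(2) invariant[OF A] q_apply[OF A]
      by (intro image_cong) (auto simp: proj_profile subset_iff)
    show "inj_on proj (W A)"
    proof (rule inj_onI)
      fix z z' assume "z \<in> W A" "z' \<in> W A" and eq: "proj z = proj z'"
      then obtain u v where uv: "u \<in> ball x r" "v \<in> ball x r"
        "z = H.profile (A *v u)" "z' = H.profile (A *v v)" by (auto simp: W_def)
      have "q u = q v" using eq uv r(2) invariant[OF A] q_apply[OF A]
        by (auto simp: proj_profile subset_iff)
      moreover have "u \<in> S" "v \<in> S" using uv r(2) by auto
      ultimately obtain C where C: "C \<in> G" "v = C *v u" using fibres[of u v] by auto
      then have "C \<in> H" using rH[OF C(1) uv(1,2)] by simp
      then have "A ** C ** transpose A \<in> H" using normal A by blast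
      moreover have "A *v v = (A ** C ** transpose A) *v (A *v u)"
        using C G.transpose_cancel(1)[OF A, of u]
        by (simp add: matrix_vector_mul_assoc[symmetric] del: transpose_matrix_vector)
      ultimately show "z = z'" unfolding uv(3,4) H.profile_eq_iff by blast
    qed
    fix V assume V: "openin (top_of_set (W A)) V"
    have "openin (top_of_set (H.profile ` S)) V" using V openW[OF A] openin_trans by blast
    then have "openin (top_of_set (q ` S)) (proj ` V)" by (rule open_proj)
    moreover have "proj ` V \<subseteq> q ` ball x r"
      using openin_imp_subset[OF V] \<open>proj ` W A = q ` ball x r\<close> by blast
    ultimately show "openin (top_of_set (q ` ball x r)) (proj ` V)"
      by (rule openin_subset_trans[OF _ _ image_mono[OF r(2)]])
  qed blast
  show "\<exists>T. y \<in> T \<and> openin (top_of_set (q ` S)) T \<and>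
          (\<exists>v. \<Union>v = H.profile ` S \<inter> proj -` T \<and>
            (\<forall>u\<in>v. openin (top_of_set (H.profile ` S)) u) \<and> pairwise disjnt v \<and>
            (\<forall>u\<in>v. \<exists>g. homeomorphism u T proj g))"
  proof (intro exI[of _ "q ` ball x r"] conjI exI[of _ "W ` G"])
    show "y \<in> q ` ball x r" using x r by auto
    show "openin (top_of_set (q ` S)) (q ` ball x r)" using r by (intro open_q) auto
    show "pairwise disjnt (W ` G)" using sheet by (auto simp: pairwise_def disjnt_def)
    show "\<Union>(W ` G) = H.profile ` S \<inter> proj -` q ` ball x r" by (rule union)
    show "\<forall>u\<in>W ` G. openin (top_of_set (H.profile ` S)) u" using openW by blast
    show "\<forall>u\<in>W ` G. \<exists>g. homeomorphism u (q ` ball x r) proj g" using homeo by blast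
  qed
qed

text \<open>
  A connected covering of a simply connected space has one sheet: the identity of the base lifts to a
  section \<open>s\<close>, and \<open>s \<circ> proj\<close> agrees with the identity at one point, hence everywhere, by
  uniqueness of lifts. As the sheets correspond to the cosets of \<open>H\<close>, the two groups coincide.
\<close>

lemma simply_connected_quotient_imp_eq:
  assumes "simply_connected (q ` S)" "locally path_connected (q ` S)"
    and "connected S" "S \<noteq> {}"
  shows "H = G"
proof (intro equalityI subset subsetI)
  fix A assume A: "A \<in> G"
  obtain x where x: "x \<in> S" using assms(4) by blast
  have base: "q x = proj (H.profile x)" using x by (simp add: proj_profile)
  obtain s where s: "continuous_on (q ` S) s" "s \<in> q ` S \<rightarrow> H.profile ` S"
      "s (q x) = H.profile x" "\<And>y. y \<in> q ` S \<Longrightarrow> proj (s y) = y"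
    by (rule covering_space_lift_strong[OF covering_space_proj imageI[OF x] imageI[OF x]
          assms(1,2) continuous_on_id _ base]) blast+
  have img: "proj ` H.profile ` S = q ` S" by (auto simp: proj_profile image_image)
  have sect: "s (q y) = H.profile y" if y: "y \<in> S" for y
  proof -
    have "(s \<circ> proj) (H.profile y) = id (H.profile y)"
    proof (rule covering_space_lift_unique[OF covering_space_proj, of "s \<circ> proj" "H.profile x" id "H.profile ` S" proj])
      show "continuous_on (H.profile ` S) (s \<circ> proj)"
        using s(1) continuous_on_proj img by (metis continuous_on_compose)
      show "connected (H.profile ` S)"
        using H.continuous_on_profile assms(3) connected_continuous_image by blast
      show "s \<circ> proj \<in> H.profile ` S \<rightarrow> H.profile ` S"
        using s(2) by (auto simp: proj_profile Pi_iff)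
    qed (use x y s continuous_on_proj img in \<open>auto simp: proj_profile\<close>)
    then show ?thesis using y by (simp add: proj_profile)
  qed
  have "q (A *v x) = q x" using fibres[of x "A *v x"] invariant A x by auto
  then have "H.profile (A *v x) = H.profile x" using sect x invariant A by metis
  then obtain B where B: "B \<in> H" "x = B *v (A *v x)" using H.profile_eq_iff by blast
  have "B ** A \<in> H"
    using stabilizer[of "B ** A" x] B A subset x G.mult_mem by (auto simp: matrix_vector_mul_assoc)
  then have "transpose B ** (B ** A) \<in> H" using B H.mult_mem H.transpose_mem by blast
  then show "A \<in> H" using H.orthogonal[OF B(1)] by (simp add: matrix_mul_assoc orthogonal_matrix_def)
qed

end

section \<open>The subgroup generated by the stabilizers\<close>

definition stabilizer_closure :: "(real^'n^'n) set \<Rightarrow> (real^'n^'n) set" where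
  "stabilizer_closure G = generate special_orthogonal {A \<in> G. \<exists>x. x \<noteq> 0 \<and> A *v x = x}"

lemma inv_special_orthogonal:
  assumes "A \<in> carrier special_orthogonal"
  shows "inv\<^bsub>special_orthogonal\<^esub> A = transpose A"
  using assms
  by (intro group.inv_equality[OF group_special_orthogonal])
     (auto simp: special_orthogonal_def orthogonal_matrix_def det_transpose)

lemma finite_orthogonal_groupI:
  assumes "subgroup G special_orthogonal" "finite G"
  shows "finite_orthogonal_group G"
proof
  show "orthogonal_matrix A" if "A \<in> G" for A
    using subgroup.subset[OF assms(1)] that by (auto simp: special_orthogonal_def)
  show "transpose A \<in> G" if "A \<in> G" for A
    using subgroup.m_inv_closed[OF assms(1) that] inv_special_orthogonal subgroup.subset[OF assms(1)] that
    by (metis subsetD)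
  show "mat 1 \<in> G" using subgroup.one_closed[OF assms(1)] by (simp add: special_orthogonal_def)
  show "A ** B \<in> G" if "A \<in> G" "B \<in> G" for A B
    using subgroup.m_closed[OF assms(1) that] by (simp add: special_orthogonal_def)
qed (rule assms)

lemma
  assumes G: "subgroup G special_orthogonal"
  shows subgroup_stabilizer_closure: "subgroup (stabilizer_closure G) special_orthogonal"
    and stabilizer_closure_subset: "stabilizer_closure G \<subseteq> G"
proof -
  show "subgroup (stabilizer_closure G) special_orthogonal"
    unfolding stabilizer_closure_def using subgroup.subset[OF G]
    by (intro group.generate_is_subgroup[OF group_special_orthogonal]) auto
  show "stabilizer_closure G \<subseteq> G"
    unfolding stabilizer_closure_def
    by (intro group.generate_subgroup_incl[OF group_special_orthogonal _ G]) auto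
qed

text \<open>The generating set is closed under conjugation, since \<open>A *v x\<close> is fixed by the conjugate by \<open>A\<close>
  of any matrix that fixes \<open>x\<close>.\<close>

lemma stabilizer_closure_normal:
  fixes G :: "(real^'n^'n) set"
  assumes G: "subgroup G special_orthogonal" "finite G" and A: "A \<in> G" "B \<in> stabilizer_closure G"
  shows "A ** B ** transpose A \<in> stabilizer_closure G"
proof -
  interpret G: finite_orthogonal_group G using G by (rule finite_orthogonal_groupI)
  let ?R = "{A \<in> G. \<exists>x. x \<noteq> 0 \<and> A *v x = x}"
  have conj: "A ** h ** transpose A \<in> ?R" if h: "h \<in> ?R" for h
  proof -
    obtain x where x: "x \<noteq> 0" "h *v x = x" using h by blast
    have "(A ** h ** transpose A) *v (A *v x) = A *v x"
      using x(2) G.transpose_cancel(1)[OF A(1), of x]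
      by (simp add: matrix_vector_mul_assoc[symmetric] del: transpose_matrix_vector)
    moreover have "A *v x \<noteq> 0" using x(1) G.norm_apply[OF A(1), of x] by (metis norm_eq_zero)
    ultimately show ?thesis using h A(1) G.mult_mem G.transpose_mem by blast
  qed
  have RC: "?R \<subseteq> carrier special_orthogonal" using subgroup.subset[OF G(1)] by blast
  have tAA: "transpose A ** A = mat 1" "A ** transpose A = mat 1"
    using G.orthogonal[OF A(1)] by (auto simp: orthogonal_matrix_def)
  show ?thesis
    using A(2) unfolding stabilizer_closure_def
  proof (induction rule: generate.induct)
    case one
    have "\<one>\<^bsub>special_orthogonal\<^esub> = (mat 1 :: real^'n^'n)" by (simp add: special_orthogonal_def)
    then show ?case using tAA generate.one[of special_orthogonal ?R] by simp
  next
    case (incl h)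
    then show ?case by (intro generate.incl conj)
  next
    case (inv h)
    have "inv\<^bsub>special_orthogonal\<^esub> (A ** h ** transpose A) = transpose (A ** h ** transpose A)"
      using conj[OF inv] RC by (intro inv_special_orthogonal) blast
    also have "\<dots> = A ** transpose h ** transpose A"
      by (simp add: matrix_transpose_mul matrix_mul_assoc)
    also have "transpose h = inv\<^bsub>special_orthogonal\<^esub> h"
      using inv RC by (intro inv_special_orthogonal[symmetric]) blast
    finally show ?case using generate.inv[OF conj[OF inv], of special_orthogonal] by simp
  next
    case (eng h1 h2)
    have "A ** (h1 ** h2) ** transpose A = (A ** h1 ** transpose A) ** (A ** h2 ** transpose A)"
      by (metis matrix_mul_assoc matrix_mul_rid tAA(1))
    then show ?case using generate.eng[OF eng.IH] by (simp add: special_orthogonal_def)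
  qed
qed

text \<open>
  Removing the origin, which is an orbit by itself, is what makes the stabilizers proper. A
  homeomorphism with Euclidean space identifies the orbit space of the punctured space with a
  punctured space, which is simply connected from dimension three on.
\<close>

theorem orbit_space_homeomorphic_imp_stabilizer_closure:
  fixes G :: "(real^'n^'n) set"
  assumes G: "subgroup G special_orthogonal" "finite G" and n: "3 \<le> CARD('n)"
    and homeo: "orbit_space G homeomorphic_space (euclidean :: (real^'n) topology)"
  shows "stabilizer_closure G = G"
proof -
  interpret G: finite_orthogonal_group G using G by (rule finite_orthogonal_groupI)
  obtain f where f: "homeomorphic_map (orbit_space G) (euclidean :: (real^'n) topology) f"
    using homeo homeomorphic_space by blast
  define q where "q x = f (lin_orbit G x)" for x
  have top: "lin_orbit G x \<in> topspace (orbit_space G)" for x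
    by (auto simp: topspace_orbit_space orbits_def)
  have q_eq: "q x = q y \<longleftrightarrow> (\<exists>A\<in>G. y = A *v x)" for x y
    unfolding q_def G.lin_orbit_eq_iff[symmetric]
    using homeomorphic_imp_injective_map[OF f] top by (auto dest: inj_onD)
  have cont: "continuous_on UNIV q"
  proof -
    have "continuous_map euclidean euclidean (f \<circ> lin_orbit G)"
      by (rule continuous_map_compose[OF quotient_imp_continuous_map[OF quotient_map_lin_orbit]
            homeomorphic_imp_continuous_map[OF f]])
    then show ?thesis by (simp add: q_def[abs_def] comp_def)
  qed
  have openq: "open (q ` U)" if "open U" for U
  proof -
    have "openin euclidean (f ` lin_orbit G ` U)"
      using G.open_lin_orbit_map[OF that] homeomorphic_imp_open_map[OF f] open_map_def by metis
    then show ?thesis by (simp add: q_def[abs_def] image_image)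
  qed
  have "range q = UNIV"
  proof -
    have "f ` lin_orbits G = UNIV"
      using homeomorphic_imp_surjective_map[OF f] by (simp add: topspace_orbit_space)
    then show ?thesis by (auto simp: q_def[abs_def] orbits_def image_def)
  qed
  moreover have "q x = q 0 \<longleftrightarrow> x = 0" for x
  proof -
    have "q 0 = q x \<longleftrightarrow> (\<exists>A\<in>G. x = 0)" using q_eq[of 0 x] by simp
    then show ?thesis using G.one_mem by auto
  qed
  ultimately have im: "q ` (- {0}) = - {q 0}" by (auto simp: image_iff)
  interpret H: finite_orthogonal_group "stabilizer_closure G"
    by (intro finite_orthogonal_groupI subgroup_stabilizer_closure[OF G(1)]
        finite_subset[OF stabilizer_closure_subset[OF G(1)] G(2)])
  interpret free_quotient_action G "stabilizer_closure G" "- {0}" q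
  proof
    show "stabilizer_closure G \<subseteq> G" using G(1) by (rule stabilizer_closure_subset)
    show "A ** B ** transpose A \<in> stabilizer_closure G" if "A \<in> G" "B \<in> stabilizer_closure G" for A B
      using stabilizer_closure_normal G that by blast
    show "A *v x \<in> - {0}" if "A \<in> G" "x \<in> - {0}" for A x
      using that G.norm_apply[OF that(1), of x] by auto
    show "A \<in> stabilizer_closure G" if "A \<in> G" "x \<in> - {0}" "A *v x = x" for A x
      using that unfolding stabilizer_closure_def by (intro generate.incl) auto
    show "continuous_on (- {0}) q" using cont continuous_on_subset by blast
    show "openin (top_of_set (q ` (- {0}))) (q ` U)" if "open U" "U \<subseteq> - {0}" for U
      using openq that by (intro open_subset image_mono) auto
  qed (use q_eq in auto)
  show ?thesis
  proof (rule simply_connected_quotient_imp_eq)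
    show "simply_connected (q ` (- {0}))" unfolding im using n by (intro simply_connected_punctured_universe) simp
    show "locally path_connected (q ` (- {0}))" unfolding im by (intro open_imp_locally_path_connected) auto
    show "connected (- {0} :: (real^'n) set)" using n by (intro connected_punctured_universe) simp
    have "(axis undefined 1 :: real^'n) \<in> - {0}" by (simp add: axis_eq_0_iff)
    then show "- {0} \<noteq> ({} :: (real^'n) set)" by blast
  qed
qed

section \<open>Matrices with a fixed vector in even dimension\<close>

lemma transpose_minus: "transpose (A - B) = transpose A - transpose (B :: 'a::ab_group_add^'n^'m)"
  by (simp add: transpose_def vec_eq_iff)

lemma transpose_plus: "transpose (A + B) = transpose A + transpose (B :: 'a::ab_group_add^'n^'m)"
  by (simp add: transpose_def vec_eq_iff)

lemma det_neg_even:
  fixes A :: "real^'n^'n"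
  assumes "even CARD('n)"
  shows "det (- A) = det A"
proof -
  have "- A = (\<chi> i. (-1) *s A $ i)" by (simp add: vec_eq_iff)
  then have "det (- A) = prod (\<lambda>i::'n. -1) UNIV * det (\<chi> i. A $ i)"
    using det_rows_mul[of "\<lambda>_. -1" "\<lambda>i. A $ i"] by simp
  then show ?thesis using assms by simp
qed

text \<open>
  The idea is the parity argument showing that a special orthogonal matrix in odd dimension has
  eigenvalue one, applied to the complement of the axis. Let \<open>P\<close> project onto the axis and
  \<open>N = B - 1 + P\<close>, which is the identity on the axis and \<open>B - 1\<close> on its complement. Multiplication
  by the transpose of \<open>B\<close> gives \<open>det N = det (1 - B + P)\<close>. Multiplication by the reflection
  \<open>R = 1 - 2 P\<close>, of determinant \<open>-1\<close>, gives \<open>- det N = det (B - 1 - P)\<close>, and this is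
  \<open>det (1 - B + P)\<close> in even dimension. So \<open>det N = 0\<close>, and a kernel vector of \<open>N\<close> is as required.
\<close>

lemma second_fixed_vector_axis:
  fixes B :: "real^'n^'n" and k :: 'n
  assumes "orthogonal_matrix B" "det B = 1" "even CARD('n)" "B *v axis k 1 = axis k 1"
  shows "\<exists>w. w \<noteq> 0 \<and> w $ k = 0 \<and> B *v w = w"
proof -
  define P :: "real^'n^'n" where "P = (\<chi> i j. if i = k \<and> j = k then 1 else 0)"
  define R :: "real^'n^'n" where "R = mat 1 - P - P"
  have Pv: "P *v v = v $ k *\<^sub>R axis k 1" for v
  proof -
    have "(P *v v) $ i = (\<Sum>j\<in>UNIV. if j = k then P $ i $ k * v $ k else 0)" for i
      unfolding matrix_vector_mult_def by (simp only: vec_lambda_beta, intro sum.cong) (auto simp: P_def)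
    then show ?thesis by (simp add: vec_eq_iff axis_def P_def)
  qed
  have PP: "P ** P = P" 
    by (simp add: matrix_eq Pv matrix_vector_mul_assoc[symmetric])
  have BP: "B ** P = P"
    using assms(4) by (simp add: matrix_eq Pv matrix_vector_mul_assoc[symmetric] matrix_vector_mult_scaleR)
  have tP: "transpose P = P" by (auto simp: P_def transpose_def vec_eq_iff)
  have tBB: "transpose B ** B = mat 1" using assms(1) by (simp add: orthogonal_matrix_def)
  have tBP: "transpose B ** P = P"
    by (metis BP matrix_mul_assoc matrix_mul_lid tBB)
  have "det R = (\<Prod>i\<in>UNIV. R $ i $ i)"
    by (rule det_diagonal) (auto simp: R_def P_def mat_def)
  also have "\<dots> = (\<Prod>i\<in>UNIV. if i = k then -1 else 1)"
    by (intro prod.cong) (auto simp: R_def P_def mat_def)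
  also have "\<dots> = -1" by simp
  finally have detR: "det R = -1" .
  define N where "N = B - mat 1 + P"
  have cancel: "transpose B *v (B *v v) = v" "transpose B *v (P *v v) = P *v v"
      "B *v (P *v v) = P *v v" "P *v (P *v v) = P *v v" for v
    using tBB tBP BP PP by (simp_all add: matrix_vector_mul_assoc del: transpose_matrix_vector)
  have "transpose B ** N = mat 1 - transpose B + P"
    unfolding N_def matrix_eq
    by (simp add: matrix_vector_mul_assoc[symmetric] matrix_vector_mult_add_rdistrib
        matrix_vector_mult_diff_rdistrib matrix_vector_right_distrib
        matrix_vector_mult_diff_distrib cancel del: transpose_matrix_vector)
  also have "\<dots> = transpose (mat 1 - B + P)"
    by (simp add: transpose_minus transpose_plus transpose_mat tP)
  finally have "transpose B ** N = transpose (mat 1 - B + P)" .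
  then have 1: "det N = det (mat 1 - B + P)"
    using assms(2) by (metis det_mul det_transpose mult_1)
  have Rv: "R *v v = v - P *v v - P *v v" for v
    by (simp only: R_def matrix_vector_mult_diff_rdistrib matrix_vector_mul_lid)
  have Nv: "N *v v = B *v v - v + P *v v" for v
    by (simp only: N_def matrix_vector_mult_add_rdistrib matrix_vector_mult_diff_rdistrib
        matrix_vector_mul_lid)
  have "N ** R = B - mat 1 - P"
    unfolding matrix_eq matrix_vector_mul_assoc[symmetric] Rv Nv matrix_vector_mult_diff_distrib
      cancel matrix_vector_mult_diff_rdistrib matrix_vector_mul_lid by simp
  then have "det N * det R = det (mat 1 - B + P)"
    using det_neg_even[OF assms(3), of "mat 1 - B + P"] by (simp flip: det_mul)
  with 1 detR have "det N = 0" by simp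
  then obtain w where w: "w \<noteq> 0" "N *v w = 0"
    using matrix_left_invertible_ker[of N] invertible_det_nz[of N]
    by (metis invertible_def matrix_left_right_inverse)
  have N: "B *v w - w + w $ k *\<^sub>R axis k 1 = 0"
    using w(2) by (simp add: N_def matrix_vector_mult_add_rdistrib matrix_vector_mult_diff_rdistrib Pv)
  have "(B *v w) $ k = w $ k"
  proof -
    have "transpose B *v axis k 1 = axis k 1"
      by (metis assms(4) matrix_vector_mul_assoc matrix_vector_mul_lid tBB)
    then have "axis k 1 \<bullet> (B *v w) = axis k 1 \<bullet> w"
      by (metis dot_lmul_matrix transpose_matrix_vector)
    then show ?thesis by (simp add: inner_axis' )
  qed
  then have k0: "w $ k = 0" using arg_cong[OF N, of "\<lambda>v. v $ k"] by simp
  then show ?thesis using N w(1) by auto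
qed

text \<open>An orthogonal change of basis moves the given fixed vector onto a coordinate axis.\<close>

lemma second_fixed_vector:
  fixes A :: "real^'n^'n"
  assumes A: "orthogonal_matrix A" "det A = 1" "even CARD('n)" and x: "x \<noteq> 0" "A *v x = x"
  shows "\<exists>w. w \<noteq> 0 \<and> x \<bullet> w = 0 \<and> A *v w = w"
proof -
  fix k :: 'n
  have "norm (x /\<^sub>R norm x) = 1" using x(1) by simp
  then obtain Q where Q: "orthogonal_matrix Q" "Q *v axis k 1 = x /\<^sub>R norm x"
    by (rule orthogonal_matrix_exists_basis)
  have QQ: "transpose Q ** Q = mat 1" "Q ** transpose Q = mat 1"
    using Q(1) by (simp_all add: orthogonal_matrix_def)
  have Q1: "transpose Q *v (Q *v v) = v" "Q *v (transpose Q *v v) = v" for v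
    using QQ by (simp_all add: matrix_vector_mul_assoc del: transpose_matrix_vector)
  let ?B = "transpose Q ** A ** Q"
  have B: "?B *v v = transpose Q *v (A *v (Q *v v))" for v
    by (simp add: matrix_vector_mul_assoc matrix_mul_assoc del: transpose_matrix_vector)
  have "orthogonal_matrix ?B"
    using A(1) Q(1) by (simp add: orthogonal_matrix_mul)
  moreover have "det ?B = 1"
    using A(2) QQ(1) by (metis det_I det_mul mult.commute mult.right_neutral)
  moreover have "?B *v axis k 1 = axis k 1"
    unfolding B using Q(2) x(2) Q1(1)[of "axis k 1"]
    by (simp add: matrix_vector_mult_scaleR del: transpose_matrix_vector)
  ultimately obtain w where w: "w \<noteq> 0" "w $ k = 0" "?B *v w = w"
    using second_fixed_vector_axis A(3) by blast
  have "A *v (Q *v w) = Q *v w" using w(3) unfolding B by (metis Q1(2))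
  moreover have "Q *v w \<noteq> 0" using w(1) Q1(1)[of w] by (metis matrix_vector_mult_0_right)
  moreover have "x \<bullet> (Q *v w) = 0"
  proof -
    have "(Q *v axis k 1) \<bullet> (Q *v w) = axis k 1 \<bullet> w"
      by (metis Q1(1) dot_lmul_matrix transpose_matrix_vector inner_commute)
    then show ?thesis using w(2) Q(2) x(1) by (simp add: inner_axis')
  qed
  ultimately show ?thesis by blast
qed

lemma is_rotation_if_fixed_vector:
  fixes A :: "real^4^4"
  assumes "orthogonal_matrix A" "det A = 1" "x \<noteq> 0" "A *v x = x"
  shows "is_rotation A"
proof -
  obtain w where w: "w \<noteq> 0" "x \<bullet> w = 0" "A *v w = w"
    using second_fixed_vector[of A x] assms by auto
  have "x \<noteq> w" using w by auto
  have "independent {x, w}"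
    using w assms(3) by (intro pairwise_orthogonal_independent)
      (auto simp: pairwise_def orthogonal_def inner_commute)
  then have "dim (span {x, w}) = 2"
    using \<open>x \<noteq> w\<close> by (simp add: dim_eq_card_independent)
  moreover have "A *v v = v" if "v \<in> span {x, w}" for v
    using that
  proof (induction rule: span_induct)
    show "subspace {v. A *v v = v}"
      by (auto simp: subspace_def matrix_vector_right_distrib matrix_vector_mult_scaleR)
  qed (use assms w in auto)
  ultimately show ?thesis
    unfolding is_rotation_def using assms by (intro conjI exI[of _ "span {x, w}"]) auto
qed

theorem corollary2p21:
  fixes G :: "(real^4^4) set"
  assumes "subgroup G special_orthogonal"
    and "finite G"
    and "\<not> generated_by_rotations G"
  shows "\<not> orbit_space G homeomorphic_space (euclidean :: (real^4) topology)"
proof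
  assume "orbit_space G homeomorphic_space (euclidean :: (real^4) topology)"
  then have "generate special_orthogonal {A \<in> G. \<exists>x. x \<noteq> 0 \<and> A *v x = x} = G"
    using orbit_space_homeomorphic_imp_stabilizer_closure[OF assms(1,2)]
    by (simp add: stabilizer_closure_def)
  moreover have "is_rotation A" if "A \<in> G" "x \<noteq> 0" "A *v x = x" for A x
  proof -
    have "orthogonal_matrix A" "det A = 1"
      using subgroup.subset[OF assms(1)] that(1) by (auto simp: special_orthogonal_def)
    then show ?thesis using that(2,3) by (rule is_rotation_if_fixed_vector)
  qed
  ultimately have "generated_by_rotations G"
    unfolding generated_by_rotations_def
    by (intro exI[of _ "{A \<in> G. \<exists>x. x \<noteq> 0 \<and> A *v x = x}"]) auto
  then show False using assms(3) by blast
qed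

end
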